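(* Let $1\leq p<\infty$. For every $k\in\mathbb{N}$ with $k\geq p$, there exists $Q\in\mathcal{P}^{k+1}(\ell_p;\mathbb{C})$ such that (1) $Q\in\operatorname{NA}\mathcal{P}^{k+1}(\ell_p;\mathbb{C})$; (2) for every $0<s<1$, $Q$ does not attain the $s$-norm. In particular, $Q\notin\operatorname{NA}_v\mathcal{P}^{k+1}(\ell_p;\mathbb{C})$.
   Context: $\ell_p$ is the complex sequence space. For a complex Banach space $X$, $B_X$ is the open unit ball and $\overline{B_X}$ the closed unit ball. $\mathcal{P}^N(X;\mathbb{C})$ is the space of (continuous) polynomials $P=\sum_{k=0}^NP_k$ of degree at most $N$, with $P_k$ a continuous $k$-homogeneous polynomial. For $s\in(0,1]$, $\|P\|_s=\sup_{x\in B_X}|P(sx)|$, and $P$ attains the $s$-norm if there is $x_0\in s\overline{B_X}$ with $|P(x_0)|=\|P\|_s$. $\|P\|_v=\sup_{x\in B_X}(1-\|x\|^2)|P(x)|$, and $P$ attains the $v$-norm if there is $x_0\in\overline{B_X}$ with $(1-\|x_0\|^2)|P(x_0)|=\|P\|_v$. $\operatorname{NA}\mathcal{P}^N(X;\mathbb{C})$ (resp. $\operatorname{NA}_v\mathcal{P}^N(X;\mathbb{C})$) is the set of $P\in\mathcal{P}^N(X;\mathbb{C})$ attaining the $1$-norm (resp. the $v$-norm). *)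

theory Defs
  imports "HOL-Analysis.Analysis"
begin

text \<open>
  The space \<open>\<ell>\<^sub>p\<close> depends on a real number, so it is a carrier set of complex sequences
  rather than a type. All notions below are relative to that carrier: values of a map
  outside \<open>lp p\<close> never matter.
\<close>

definition lp :: "real \<Rightarrow> (nat \<Rightarrow> complex) set" where
  "lp p = {x. summable (\<lambda>n. cmod (x n) powr p)}"

definition lp_norm :: "real \<Rightarrow> (nat \<Rightarrow> complex) \<Rightarrow> real" where
  "lp_norm p x = (\<Sum>n. cmod (x n) powr p) powr (1 / p)"

definition lp_dist :: "real \<Rightarrow> (nat \<Rightarrow> complex) \<Rightarrow> (nat \<Rightarrow> complex) \<Rightarrow> real" where
  "lp_dist p x y = lp_norm p (\<lambda>n. x n - y n)"

definition lp_topology :: "real \<Rightarrow> (nat \<Rightarrow> complex) topology" where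
  "lp_topology p = Metric_space.mtopology (lp p) (lp_dist p)"

lemma lp_norm_nonneg: "0 \<le> lp_norm p x"
  by (simp add: lp_norm_def)

lemma lp_norm_powr:
  assumes "1 \<le> p" "x \<in> lp p"
  shows "lp_norm p x powr p = (\<Sum>n. cmod (x n) powr p)"
  using assms by (simp add: lp_norm_def lp_def powr_powr suminf_nonneg)

lemma lp_norm_eq_0:
  assumes "1 \<le> p" "x \<in> lp p"
  shows "lp_norm p x = 0 \<longleftrightarrow> x = (\<lambda>n. 0)"
proof -
  have "lp_norm p x = 0 \<longleftrightarrow> (\<Sum>n. cmod (x n) powr p) = 0"
    by (simp add: lp_norm_def)
  also have "\<dots> \<longleftrightarrow> (\<forall>n. cmod (x n) powr p = 0)"
    using assms by (intro suminf_eq_zero_iff) (auto simp: lp_def)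
  finally show ?thesis by auto
qed

lemma powr_convex_combination:
  fixes p u v t :: real
  assumes p: "1 \<le> p" and u: "0 \<le> u" and v: "0 \<le> v" and t: "0 \<le> t" "t \<le> 1"
  shows "((1 - t) * u + t * v) powr p \<le> (1 - t) * u powr p + t * v powr p"
proof -
  have *: "(c * w) powr p \<le> c * w powr p" if "0 \<le> c" "c \<le> 1" "0 \<le> w" for c w :: real
  proof -
    have "c powr p \<le> c powr 1"
      using that p by (intro powr_mono') auto
    then show ?thesis
      using that by (simp add: powr_mult mult_right_mono)
  qed
  show ?thesis
  proof (cases "u = 0 \<or> v = 0")
    case True
    then show ?thesis
      using *[of t v] *[of "1 - t" u] t u v p by auto
  next
    case False
    then show ?thesis
      using convex_onD[OF powr_convex[OF p] t, of u v] u v by simp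
  qed
qed

lemma lp_minkowski:
  assumes p: "1 \<le> p" and x: "x \<in> lp p" and y: "y \<in> lp p"
  shows "(\<lambda>n. x n + y n) \<in> lp p"
    and "lp_norm p (\<lambda>n. x n + y n) \<le> lp_norm p x + lp_norm p y"
proof -
  have main: "(\<lambda>n. x n + y n) \<in> lp p \<and> lp_norm p (\<lambda>n. x n + y n) \<le> lp_norm p x + lp_norm p y"
  proof (cases "lp_norm p x = 0 \<or> lp_norm p y = 0")
    case True
    then show ?thesis
      using assms lp_norm_eq_0[OF p x] lp_norm_eq_0[OF p y] lp_norm_nonneg by auto
  next
    case False
    define a b where "a = lp_norm p x" and "b = lp_norm p y"
    have a: "a > 0" and b: "b > 0"
      using False lp_norm_nonneg[of p x] lp_norm_nonneg[of p y] by (auto simp: a_def b_def)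
    define f where "f n = (a + b) powr p *
      (a / (a + b) * (cmod (x n) powr p / a powr p) + b / (a + b) * (cmod (y n) powr p / b powr p))"
      for n
    have le: "cmod (x n + y n) powr p \<le> f n" for n
    proof -
      define u v where "u = cmod (x n) / a" and "v = cmod (y n) / b"
      have uv: "u \<ge> 0" "v \<ge> 0" using a b by (auto simp: u_def v_def)
      have conv: "(a / (a + b) * u + b / (a + b) * v) powr p
          \<le> a / (a + b) * u powr p + b / (a + b) * v powr p"
        using powr_convex_combination[OF p uv, of "b / (a + b)"] a b by (simp add: field_simps)
      have "cmod (x n + y n) powr p \<le> (cmod (x n) + cmod (y n)) powr p"
        using p by (intro powr_mono2 norm_triangle_ineq) auto
      also have "cmod (x n) + cmod (y n) = (a + b) * (a / (a + b) * u + b / (a + b) * v)"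
        using a b by (simp add: u_def v_def distrib_left)
      also have "\<dots> powr p = (a + b) powr p * (a / (a + b) * u + b / (a + b) * v) powr p"
        using a b uv by (simp add: powr_mult)
      also have "\<dots> \<le> (a + b) powr p * (a / (a + b) * u powr p + b / (a + b) * v powr p)"
        by (intro mult_left_mono conv) auto
      also have "\<dots> = f n"
        using a b by (simp add: f_def u_def v_def powr_divide)
      finally show ?thesis .
    qed
    have "(\<lambda>n. cmod (x n) powr p) sums (a powr p)" "(\<lambda>n. cmod (y n) powr p) sums (b powr p)"
      using x y lp_norm_powr[OF p x] lp_norm_powr[OF p y]
      by (auto simp: a_def b_def lp_def summable_sums)
    then have "f sums ((a + b) powr p *
        (a / (a + b) * (a powr p / a powr p) + b / (a + b) * (b powr p / b powr p)))"
      unfolding f_def by (intro sums_mult sums_add sums_divide)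
    also have "(a + b) powr p *
        (a / (a + b) * (a powr p / a powr p) + b / (a + b) * (b powr p / b powr p)) = (a + b) powr p"
      using a b by (simp add: add_divide_distrib[symmetric])
    finally have f: "f sums ((a + b) powr p)" .
    have sm: "summable (\<lambda>n. cmod (x n + y n) powr p)"
      by (rule summable_comparison_test[OF _ sums_summable[OF f]]) (use le in auto)
    have "(\<Sum>n. cmod (x n + y n) powr p) \<le> (a + b) powr p"
      using suminf_le[OF le sm sums_summable[OF f]] sums_unique[OF f] by simp
    then have "lp_norm p (\<lambda>n. x n + y n) \<le> ((a + b) powr p) powr (1 / p)"
      unfolding lp_norm_def using p sm by (intro powr_mono2) (auto intro: suminf_nonneg)
    also have "\<dots> = a + b"
      using a b p by (simp add: powr_powr)
    finally show ?thesis
      using sm by (simp add: lp_def a_def b_def)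
  qed
  show "(\<lambda>n. x n + y n) \<in> lp p" "lp_norm p (\<lambda>n. x n + y n) \<le> lp_norm p x + lp_norm p y"
    using main by auto
qed

lemma lp_scale:
  assumes "1 \<le> p" "x \<in> lp p"
  shows "(\<lambda>n. c * x n) \<in> lp p" and "lp_norm p (\<lambda>n. c * x n) = cmod c * lp_norm p x"
proof -
  have eq: "cmod (c * x n) powr p = cmod c powr p * cmod (x n) powr p" for n
    by (simp add: norm_mult powr_mult)
  show "(\<lambda>n. c * x n) \<in> lp p"
    using assms by (simp add: lp_def eq summable_mult)
  show "lp_norm p (\<lambda>n. c * x n) = cmod c * lp_norm p x"
    using assms unfolding lp_norm_def eq
    by (simp add: lp_def suminf_mult powr_mult powr_powr suminf_nonneg)
qed

lemma Metric_space_lp: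
  assumes p: "1 \<le> p"
  shows "Metric_space (lp p) (lp_dist p)"
proof
  fix x y z
  show "0 \<le> lp_dist p x y" by (simp add: lp_dist_def lp_norm_nonneg)
  show "lp_dist p x y = lp_dist p y x" by (simp add: lp_dist_def lp_norm_def norm_minus_commute)
  have diff: "(\<lambda>n. x n - y n) \<in> lp p" if "x \<in> lp p" "y \<in> lp p" for x y
    using lp_minkowski(1)[OF p that(1) lp_scale(1)[OF p that(2), of "-1"]] by simp
  assume x: "x \<in> lp p" and y: "y \<in> lp p"
  show "lp_dist p x y = 0 \<longleftrightarrow> x = y"
    using lp_norm_eq_0[OF p diff[OF x y]] by (auto simp: lp_dist_def fun_eq_iff)
  assume z: "z \<in> lp p"
  show "lp_dist p x z \<le> lp_dist p x y + lp_dist p y z"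
    using lp_minkowski(2)[OF p diff[OF x y] diff[OF y z]] by (simp add: lp_dist_def)
qed

definition lp_ball :: "real \<Rightarrow> (nat \<Rightarrow> complex) set" where
  "lp_ball p = {x \<in> lp p. lp_norm p x < 1}"

definition lp_cball :: "real \<Rightarrow> (nat \<Rightarrow> complex) set" where
  "lp_cball p = {x \<in> lp p. lp_norm p x \<le> 1}"

text \<open>Elements of \<open>\<ell>\<^sub>p \<times> \<dots> \<times> \<ell>\<^sub>p\<close> (\<open>k\<close> factors) are lists of length \<open>k\<close>.\<close>

definition multilinear_lp :: "real \<Rightarrow> nat \<Rightarrow> ((nat \<Rightarrow> complex) list \<Rightarrow> complex) \<Rightarrow> bool" where
  "multilinear_lp p k A \<longleftrightarrow>
     (\<forall>xs \<in> lists (lp p). length xs = k \<longrightarrow>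
       (\<forall>i<k. \<forall>u \<in> lp p. \<forall>v \<in> lp p. \<forall>a b.
          A (xs[i := (\<lambda>n. a * u n + b * v n)]) = a * A (xs[i := u]) + b * A (xs[i := v])))"

text \<open>For \<open>k = 0\<close> the homogeneous polynomials are the constants.\<close>

definition continuous_hom_poly_lp ::
    "real \<Rightarrow> nat \<Rightarrow> ((nat \<Rightarrow> complex) \<Rightarrow> complex) \<Rightarrow> bool" where
  "continuous_hom_poly_lp p k P \<longleftrightarrow>
     (\<exists>A. multilinear_lp p k A \<and> (\<forall>x \<in> lp p. P x = A (replicate k x))) \<and>
     continuous_map (lp_topology p) euclidean P"

definition poly_lp :: "real \<Rightarrow> nat \<Rightarrow> ((nat \<Rightarrow> complex) \<Rightarrow> complex) set" where
  "poly_lp p N = {P. \<exists>H. (\<forall>k\<le>N. continuous_hom_poly_lp p k (H k)) \<and>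
                        (\<forall>x \<in> lp p. P x = (\<Sum>k\<le>N. H k x))}"

text \<open>
  Continuous polynomials are bounded on bounded sets, so the following real suprema are
  those of nonempty bounded sets when \<open>P \<in> poly_lp p N\<close>.
\<close>

definition s_norm :: "real \<Rightarrow> real \<Rightarrow> ((nat \<Rightarrow> complex) \<Rightarrow> complex) \<Rightarrow> real" where
  "s_norm p s P = (SUP x \<in> lp_ball p. cmod (P (\<lambda>n. of_real s * x n)))"

definition attains_s_norm :: "real \<Rightarrow> real \<Rightarrow> ((nat \<Rightarrow> complex) \<Rightarrow> complex) \<Rightarrow> bool" where
  "attains_s_norm p s P \<longleftrightarrow>
     (\<exists>x0 \<in> (\<lambda>x n. of_real s * x n) ` lp_cball p. cmod (P x0) = s_norm p s P)"

definition v_norm :: "real \<Rightarrow> ((nat \<Rightarrow> complex) \<Rightarrow> complex) \<Rightarrow> real" where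
  "v_norm p P = (SUP x \<in> lp_ball p. (1 - (lp_norm p x)\<^sup>2) * cmod (P x))"

definition attains_v_norm :: "real \<Rightarrow> ((nat \<Rightarrow> complex) \<Rightarrow> complex) \<Rightarrow> bool" where
  "attains_v_norm p P \<longleftrightarrow>
     (\<exists>x0 \<in> lp_cball p. (1 - (lp_norm p x0)\<^sup>2) * cmod (P x0) = v_norm p P)"

definition NA_poly :: "real \<Rightarrow> nat \<Rightarrow> ((nat \<Rightarrow> complex) \<Rightarrow> complex) set" where
  "NA_poly p N = {P \<in> poly_lp p N. attains_s_norm p 1 P}"

definition NA_v_poly :: "real \<Rightarrow> nat \<Rightarrow> ((nat \<Rightarrow> complex) \<Rightarrow> complex) set" where
  "NA_v_poly p N = {P \<in> poly_lp p N. attains_v_norm p P}"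

end

(*
  Take Q x = x_0^(k+1) + sum_n n/(n+1) x_n^k. Since k >= p, the sum of the |x_n|^k is at most
  ||x||^k, hence |Q x| <= ||x||^k on the closed unit ball. The multiples c e_n of the unit
  vectors show that ||x||^k is the best bound on every sphere, while all weights are less
  than 1 and the extra factor |x_0| is less than 1 inside the ball, so equality fails whenever
  0 < ||x|| < 1. On the unit sphere equality holds at e_0.
*)
theory Submission
  imports Defs
begin

section \<open>Power sums of p-summable sequences\<close>

lemma norm_le_lp_norm:
  assumes "1 \<le> p" "x \<in> lp p"
  shows "cmod (x n) \<le> lp_norm p x"
proof -
  have "cmod (x n) powr p \<le> (\<Sum>n. cmod (x n) powr p)"
    using assms sum_le_suminf[of "\<lambda>n. cmod (x n) powr p" "{n}"] by (simp add: lp_def)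
  then have "(cmod (x n) powr p) powr (1 / p) \<le> lp_norm p x"
    unfolding lp_norm_def using assms by (intro powr_mono2) auto
  then show ?thesis
    using assms by (simp add: powr_powr)
qed

text \<open>Split the exponent as \<open>(k - p) + p\<close>. Each coordinate is at most the norm
  \<open>r\<close>, so the first factor is at most \<open>r powr (real k - p)\<close>, while the
  second one sums to \<open>r powr p\<close>.\<close>

lemma lp_power_sum:
  assumes p: "1 \<le> p" "p \<le> real k" and x: "x \<in> lp p"
  shows "summable (\<lambda>n. cmod (x n) ^ k)"
    and "(\<Sum>n. cmod (x n) ^ k) \<le> lp_norm p x ^ k"
proof -
  define r where "r = lp_norm p x"
  have r: "0 \<le> r" by (simp add: r_def lp_norm_nonneg)
  have k: "k \<noteq> 0" using p by auto
  have le: "cmod (x n) ^ k \<le> r powr (real k - p) * cmod (x n) powr p" for n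
  proof -
    \<comment> \<open>This covers zero coordinates as well: \<open>0 powr a = 0\<close> even for
      \<open>a = 0\<close>, and \<open>0 ^ k = 0\<close> because \<open>k\<close> is
      nonzero.\<close>
    have "cmod (x n) ^ k = cmod (x n) powr (real k - p) * cmod (x n) powr p"
      using k by (simp add: powr_add[symmetric] powr_realpow')
    also have "\<dots> \<le> r powr (real k - p) * cmod (x n) powr p"
      using p norm_le_lp_norm[OF p(1) x] by (intro mult_right_mono powr_mono2) (auto simp: r_def)
    finally show ?thesis .
  qed
  have sm: "summable (\<lambda>n. cmod (x n) powr p)"
    using x by (simp add: lp_def)
  show sum: "summable (\<lambda>n. cmod (x n) ^ k)"
    by (rule summable_comparison_test[OF _ summable_mult[OF sm, of "r powr (real k - p)"]])
      (use le in auto)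
  have "(\<Sum>n. cmod (x n) ^ k) \<le> (\<Sum>n. r powr (real k - p) * cmod (x n) powr p)"
    by (intro suminf_le le sum summable_mult sm)
  also have "\<dots> = r powr (real k - p) * r powr p"
    using lp_norm_powr[OF p(1) x] sm by (simp add: suminf_mult r_def)
  also have "\<dots> = r ^ k"
    using r k by (simp add: powr_add[symmetric] powr_realpow')
  finally show "(\<Sum>n. cmod (x n) ^ k) \<le> lp_norm p x ^ k"
    by (simp add: r_def)
qed

lemma lp_unit:
  assumes "1 \<le> p"
  shows "(\<lambda>n. if n = m then c else 0) \<in> lp p"
    and "lp_norm p (\<lambda>n. if n = m then c else 0) = cmod c"
proof -
  have eq: "cmod (if n = m then c else 0) powr p = (if n = m then cmod c powr p else 0)" for n
    by auto
  have s: "(\<lambda>n. if n = m then cmod c powr p else 0) sums (cmod c powr p)"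
    using sums_single[of m "\<lambda>_. cmod c powr p"] .
  show "(\<lambda>n. if n = m then c else 0) \<in> lp p"
    unfolding lp_def mem_Collect_eq eq using sums_summable[OF s] .
  show "lp_norm p (\<lambda>n. if n = m then c else 0) = cmod c"
    unfolding lp_norm_def eq using sums_unique[OF s] assms by (simp add: powr_powr)
qed

section \<open>Diagonal polynomials: multilinear forms and continuity\<close>

definition diag_poly :: "(nat \<Rightarrow> complex) \<Rightarrow> nat \<Rightarrow> (nat \<Rightarrow> complex) \<Rightarrow> complex" where
  "diag_poly a k x = (\<Sum>n. a n * x n ^ k)"

lemma diag_poly_unit:
  assumes "k \<noteq> 0"
  shows "diag_poly a k (\<lambda>n. if n = m then c else 0) = a m * c ^ k"
  unfolding diag_poly_def
  using suminf_finite[of "{m}" "\<lambda>n. a n * (if n = m then c else 0) ^ k"] assms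
  by (simp add: power_0_left)

text \<open>The largest modulus \<open>M\<close> bounds every factor, and
  \<open>M ^ length ys\<close> is itself one of the summands. This crude bound stands in for the
  generalized Hoelder inequality.\<close>

lemma norm_prod_list_le_power_sum:
  fixes ys :: "complex list"
  assumes "ys \<noteq> []"
  shows "cmod (prod_list ys) \<le> (\<Sum>y\<leftarrow>ys. cmod y ^ length ys)"
proof -
  define M where "M = Max (set (map cmod ys))"
  \<comment> \<open>Stated for all lists with entries from \<open>ys\<close>, so that
    \<open>M\<close> stays fixed during the induction.\<close>
  have le: "cmod (prod_list zs) \<le> M ^ length zs" if "set zs \<subseteq> set ys" for zs
    using that
  proof (induction zs)
    case (Cons z zs)
    have "cmod z \<le> M"
      unfolding M_def using Cons.prems by (intro Max_ge) auto
    then show ?case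
      using Cons order_trans[OF norm_ge_zero] by (auto simp: norm_mult intro!: mult_mono)
  qed simp
  have "M \<in> set (map cmod ys)"
    unfolding M_def using assms by (intro Max_in) auto
  then obtain y where y: "y \<in> set ys" "M = cmod y"
    by auto
  have "cmod (prod_list ys) \<le> M ^ length ys"
    by (rule le) simp
  also have "\<dots> \<le> (\<Sum>y\<leftarrow>ys. cmod y ^ length ys)"
    using y by (intro member_le_sum_list) auto
  finally show ?thesis .
qed

lemma summable_sum_list:
  fixes f :: "'a \<Rightarrow> nat \<Rightarrow> real"
  assumes "\<And>x. x \<in> set xs \<Longrightarrow> summable (f x)"
  shows "summable (\<lambda>n. \<Sum>x\<leftarrow>xs. f x n)"
  using assms by (induction xs) (auto intro: summable_add)

lemma summable_weighted:
  fixes a :: "nat \<Rightarrow> complex"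
  assumes "\<And>n. cmod (a n) \<le> 1" "\<And>n. cmod (f n) \<le> g n" "summable g"
  shows "summable (\<lambda>n. a n * f n)"
proof (rule summable_comparison_test[OF _ assms(3)])
  have "cmod (a n * f n) \<le> g n" for n
    using mult_mono[OF assms(1)[of n] assms(2)[of n]] by (simp add: norm_mult)
  then show "\<exists>N. \<forall>n\<ge>N. cmod (a n * f n) \<le> g n"
    by blast
qed

text \<open>At each coordinate the product is dominated by a finite sum of k-th powers, each
  summable because \<open>p \<le> real k\<close>. Multilinearity rests on this convergence, since
  \<open>suminf\<close> can only be split over convergent series.\<close>

lemma summable_diag_form:
  assumes p: "1 \<le> p" "p \<le> real k" and a: "\<And>n. cmod (a n) \<le> 1"
    and xs: "set xs \<subseteq> lp p" "length xs = k"
  shows "summable (\<lambda>n. a n * (\<Prod>x\<leftarrow>xs. x n))"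
proof (rule summable_weighted[OF a])
  have "xs \<noteq> []" using p xs by auto
  then show "cmod (\<Prod>x\<leftarrow>xs. x n) \<le> (\<Sum>x\<leftarrow>xs. cmod (x n) ^ k)" for n
    using norm_prod_list_le_power_sum[of "map (\<lambda>x. x n) xs"] xs by (simp add: comp_def)
  show "summable (\<lambda>n. \<Sum>x\<leftarrow>xs. cmod (x n) ^ k)"
    by (rule summable_sum_list) (use lp_power_sum(1)[OF p] xs in auto)
qed

lemma multilinear_diag:
  assumes p: "1 \<le> p" "p \<le> real k" and a: "\<And>n. cmod (a n) \<le> 1"
  shows "multilinear_lp p k (\<lambda>xs. \<Sum>n. a n * (\<Prod>x\<leftarrow>xs. x n))"
  unfolding multilinear_lp_def
proof (intro ballI impI allI)
  fix xs i u v b c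
  assume xs: "xs \<in> lists (lp p)" "length xs = k" "i < k" and uv: "u \<in> lp p" "v \<in> lp p"
  define w where "w = (\<lambda>n. b * u n + c * v n :: complex)"
  have sum: "summable (\<lambda>n. a n * (\<Prod>x\<leftarrow>xs[i := y]. x n))" if "y \<in> lp p" for y
    using xs that set_update_subset_insert[of xs i y]
    by (intro summable_diag_form[OF p a]) auto
  \<comment> \<open>Cutting the list at position \<open>i\<close> exposes that entry as a single
    factor, so each term of the series is linear in it.\<close>
  have eq: "a n * (\<Prod>x\<leftarrow>xs[i := w]. x n) =
      b * (a n * (\<Prod>x\<leftarrow>xs[i := u]. x n)) + c * (a n * (\<Prod>x\<leftarrow>xs[i := v]. x n))" for n
    using xs by (simp add: upd_conv_take_nth_drop w_def algebra_simps)
  show "(\<Sum>n. a n * (\<Prod>x\<leftarrow>xs[i := (\<lambda>n. b * u n + c * v n)]. x n)) =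
      b * (\<Sum>n. a n * (\<Prod>x\<leftarrow>xs[i := u]. x n)) + c * (\<Sum>n. a n * (\<Prod>x\<leftarrow>xs[i := v]. x n))"
    unfolding w_def[symmetric] eq
    using sum[OF uv(1)] sum[OF uv(2)]
    by (simp add: suminf_add[symmetric] suminf_mult summable_mult)
qed

text \<open>
  The free scale \<open>d\<close> replaces Hoelder's inequality: with \<open>d = lp_norm p (x - y)\<close> the sum of the
  right-hand side over all coordinates is at most linear in \<open>d\<close>.
\<close>
lemma norm_power_diff_le:
  fixes x y :: complex
  assumes d: "0 < d"
  shows "cmod (x ^ k - y ^ k) \<le>
    real k * d * ((1 / d) ^ k * cmod (x - y) ^ k + cmod x ^ k + cmod y ^ k)"
proof (cases k)
  case (Suc m)
  define h where "h = cmod (x - y) / d"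
  define S where "S = h ^ k + cmod x ^ k + cmod y ^ k"
  have h: "0 \<le> h" using d by (simp add: h_def)
  \<comment> \<open>The left-hand side is a product of \<open>j + (m - j) + 1 = k\<close> factors,
    each at most the maximum \<open>M\<close> of \<open>h\<close>, \<open>cmod x\<close> and
    \<open>cmod y\<close>; and \<open>M ^ k\<close> is one of the three summands of
    \<open>S\<close>.\<close>
  have le: "cmod (x ^ j * y ^ (m - j)) * h \<le> S" if "j < Suc m" for j
  proof -
    define M where "M = max h (max (cmod x) (cmod y))"
    have "cmod (x ^ j * y ^ (m - j)) * h \<le> (M ^ j * M ^ (m - j)) * M"
      unfolding norm_mult norm_power using h
      by (intro mult_mono power_mono) (auto simp: M_def)
    also have "\<dots> = M ^ k"
      using that Suc by (simp add: power_add[symmetric])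
    also have "\<dots> \<le> S"
      using h by (auto simp: M_def S_def max_def)
    finally show ?thesis .
  qed
  have "x ^ k - y ^ k = (x - y) * (\<Sum>j<Suc m. x ^ j * y ^ (m - j))"
    using diff_power_eq_sum[of x m y] Suc by simp
  then have "cmod (x ^ k - y ^ k) = d * h * cmod (\<Sum>j<Suc m. x ^ j * y ^ (m - j))"
    using d by (simp add: norm_mult h_def del: sum.lessThan_Suc)
  also have "\<dots> \<le> d * h * (\<Sum>j<Suc m. cmod (x ^ j * y ^ (m - j)))"
    using d h by (intro mult_left_mono norm_sum) auto
  also have "\<dots> = d * (\<Sum>j<Suc m. cmod (x ^ j * y ^ (m - j)) * h)"
    by (simp add: sum_distrib_left sum_distrib_right mult_ac del: sum.lessThan_Suc)
  also have "\<dots> \<le> d * (\<Sum>j<Suc m. S)"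
    using d le by (intro mult_left_mono sum_mono) auto
  also have "\<dots> = real k * d * S"
    using Suc by simp
  finally show ?thesis
    by (simp add: S_def h_def power_divide)
qed simp

lemma summable_diag_poly:
  assumes p: "1 \<le> p" "p \<le> real k" and a: "\<And>n. cmod (a n) \<le> 1" and x: "x \<in> lp p"
  shows "summable (\<lambda>n. a n * x n ^ k)"
  by (rule summable_weighted[OF a _ lp_power_sum(1)[OF p x]]) (simp add: norm_power)

text \<open>Sum \<open>norm_power_diff_le\<close> over the coordinates with \<open>d\<close> the
  distance of \<open>x\<close> and \<open>y\<close>. The rescaled differences then contribute at
  most \<open>(1 / d) ^ k * d ^ k\<close>, which is the 1 in the bound. The scale must be positive,
  hence the separate case \<open>x = y\<close>.\<close>

lemma diag_poly_diff_le:
  assumes p: "1 \<le> p" "p \<le> real k" and a: "\<And>n. cmod (a n) \<le> 1"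
    and x: "x \<in> lp p" and y: "y \<in> lp p"
  shows "cmod (diag_poly a k x - diag_poly a k y) \<le>
    real k * lp_dist p x y * (1 + lp_norm p x ^ k + lp_norm p y ^ k)"
proof (cases "x = y")
  case True
  then show ?thesis
    by (simp add: lp_dist_def lp_norm_nonneg)
next
  case False
  interpret Metric_space "lp p" "lp_dist p" by (rule Metric_space_lp[OF p(1)])
  define d where "d = lp_dist p x y"
  have d: "d > 0" using False x y by (simp add: d_def)
  define z where "z = (\<lambda>n. x n - y n)"
  have z: "z \<in> lp p"
    using lp_minkowski(1)[OF p(1) x lp_scale(1)[OF p(1) y, of "-1"]] by (simp add: z_def)
  define g where
    "g n = real k * d * ((1 / d) ^ k * cmod (z n) ^ k + cmod (x n) ^ k + cmod (y n) ^ k)" for n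
  note sm = lp_power_sum(1)[OF p z] lp_power_sum(1)[OF p x] lp_power_sum(1)[OF p y]
  have g: "g sums (real k * d * ((1 / d) ^ k * (\<Sum>n. cmod (z n) ^ k) +
      (\<Sum>n. cmod (x n) ^ k) + (\<Sum>n. cmod (y n) ^ k)))"
    unfolding g_def by (intro sums_mult sums_add summable_sums sm)
  have le: "cmod (a n * x n ^ k - a n * y n ^ k) \<le> g n" for n
  proof -
    have "cmod (a n * x n ^ k - a n * y n ^ k) = cmod (a n) * cmod (x n ^ k - y n ^ k)"
      by (simp add: norm_mult[symmetric] right_diff_distrib)
    also have "\<dots> \<le> 1 * g n"
      unfolding g_def z_def by (intro mult_mono a norm_power_diff_le d) auto
    finally show ?thesis by simp
  qed
  have "diag_poly a k x - diag_poly a k y = (\<Sum>n. a n * x n ^ k - a n * y n ^ k)"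
    unfolding diag_poly_def by (intro suminf_diff summable_diag_poly[OF p a] x y)
  also have "cmod \<dots> \<le> suminf g"
    by (intro norm_suminf_le le sums_summable[OF g])
  also have "\<dots> = real k * d * ((1 / d) ^ k * (\<Sum>n. cmod (z n) ^ k) +
      (\<Sum>n. cmod (x n) ^ k) + (\<Sum>n. cmod (y n) ^ k))"
    using sums_unique[OF g] by simp
  also have "\<dots> \<le> real k * d * ((1 / d) ^ k * d ^ k + lp_norm p x ^ k + lp_norm p y ^ k)"
    using d lp_power_sum(2)[OF p z] lp_power_sum(2)[OF p x] lp_power_sum(2)[OF p y]
    by (intro mult_left_mono add_mono) (auto simp: d_def lp_dist_def z_def)
  also have "(1 / d) ^ k * d ^ k = 1"
    using d by (simp add: power_mult_distrib[symmetric])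
  finally show ?thesis by (simp add: d_def)
qed

lemma continuous_map_diag_poly:
  assumes p: "1 \<le> p" "p \<le> real k" and a: "\<And>n. cmod (a n) \<le> 1"
  shows "continuous_map (lp_topology p) euclidean (diag_poly a k)"
proof -
  interpret Metric_space "lp p" "lp_dist p" by (rule Metric_space_lp[OF p(1)])
  have "continuous_map mtopology Met_TC.mtopology (diag_poly a k)"
    unfolding metric_continuous_map[OF Met_TC.Metric_space_axioms]
  proof (intro conjI ballI allI impI)
    fix y and e :: real
    assume y: "y \<in> lp p" and e: "0 < e"
    \<comment> \<open>For \<open>x\<close> within distance 1 of \<open>y\<close> the norm of
      \<open>x\<close> is at most \<open>lp_norm p y + 1\<close>, so \<open>C\<close> serves as a
      Lipschitz constant at \<open>y\<close> there. This explains the radius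
      \<open>min 1 (e / C)\<close> below.\<close>
    define C where "C = real k * (1 + (lp_norm p y + 1) ^ k + lp_norm p y ^ k)"
    have C: "0 < C"
      using p lp_norm_nonneg[of p y] by (auto simp: C_def intro!: mult_pos_pos add_pos_nonneg)
    show "\<exists>d>0. \<forall>x. x \<in> lp p \<and> lp_dist p y x < d \<longrightarrow>
        dist (diag_poly a k y) (diag_poly a k x) < e"
    proof (intro exI[of _ "min 1 (e / C)"] conjI allI impI)
      show "0 < min 1 (e / C)" using C e by simp
      fix x assume "x \<in> lp p \<and> lp_dist p y x < min 1 (e / C)"
      then have x: "x \<in> lp p" and d: "lp_dist p x y < 1" "lp_dist p x y * C < e"
        using C by (auto simp: commute[of x y] field_simps)
      \<comment> \<open>The norm is the distance to the zero sequence, which is a unit vector with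
        coefficient 0.\<close>
      have "lp_norm p x \<le> lp_norm p y + lp_dist p x y"
        using triangle[of x y "\<lambda>n. 0"] x y lp_unit(1)[OF p(1), of 0 0]
        by (simp add: lp_dist_def)
      then have nx: "lp_norm p x \<le> lp_norm p y + 1"
        using d by simp
      have "cmod (diag_poly a k x - diag_poly a k y) \<le>
          real k * lp_dist p x y * (1 + lp_norm p x ^ k + lp_norm p y ^ k)"
        by (rule diag_poly_diff_le[OF p a x y])
      also have "\<dots> \<le> real k * lp_dist p x y * (1 + (lp_norm p y + 1) ^ k + lp_norm p y ^ k)"
        using nx lp_norm_nonneg by (intro mult_left_mono add_mono power_mono) auto
      also have "\<dots> < e"
        using d by (simp add: C_def mult_ac)
      finally show "dist (diag_poly a k y) (diag_poly a k x) < e"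
        by (simp add: dist_norm norm_minus_commute)
    qed
  qed auto
  then show ?thesis
    by (simp add: lp_topology_def)
qed

lemma continuous_hom_poly_diag:
  assumes "1 \<le> p" "p \<le> real k" "\<And>n. cmod (a n) \<le> 1"
  shows "continuous_hom_poly_lp p k (diag_poly a k)"
  unfolding continuous_hom_poly_lp_def
  using multilinear_diag[OF assms] continuous_map_diag_poly[OF assms]
  by (intro conjI exI[of _ "\<lambda>xs. \<Sum>n. a n * (\<Prod>x\<leftarrow>xs. x n)"]) (auto simp: diag_poly_def)

text \<open>Fills the degrees below \<open>k\<close>, since \<open>poly_lp\<close> asks for a
  homogeneous part in every degree.\<close>

lemma continuous_hom_poly_zero: "continuous_hom_poly_lp p k (\<lambda>x. 0)"
  unfolding continuous_hom_poly_lp_def multilinear_lp_def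
  by (intro conjI exI[of _ "\<lambda>xs. 0"]) auto

section \<open>The polynomial \<open>Q\<close> and its pointwise bounds\<close>

locale weighted_lp =
  fixes p :: real and k :: nat
  assumes p: "1 \<le> p" "p \<le> real k"
begin

text \<open>The weights approach 1 without reaching it. The weight 0 at index 0 leaves that
  coordinate to the term of degree \<open>k + 1\<close> alone.\<close>

definition wt :: "nat \<Rightarrow> real" where
  "wt n = real n / (real n + 1)"

definition Q :: "(nat \<Rightarrow> complex) \<Rightarrow> complex" where
  "Q x = x 0 ^ (k + 1) + diag_poly (\<lambda>n. of_real (wt n)) k x"

lemma k_pos: "0 < k"
  using p by linarith

lemma wt: "0 \<le> wt n" "wt n < 1" "wt 0 = 0" "cmod (of_real (wt n)) \<le> 1"
  unfolding norm_of_real by (auto simp: wt_def)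

lemma wt_tendsto: "wt \<longlonglongrightarrow> 1"
  using LIMSEQ_n_over_Suc_n[where 'a = real] by (simp add: wt_def[abs_def] add.commute)

lemma Q_unit:
  "Q (\<lambda>n. if n = m then c else 0) = (if m = 0 then c ^ (k + 1) else of_real (wt m) * c ^ k)"
  using k_pos by (simp add: Q_def diag_poly_unit wt)

lemma Q_in_poly: "Q \<in> poly_lp p (k + 1)"
proof -
  \<comment> \<open>With the weights \<open>e0\<close>, the power \<open>x 0 ^ (k + 1)\<close> is a
    diagonal polynomial too, so both parts of \<open>Q\<close> are covered by the same
    lemma.\<close>
  define e0 :: "nat \<Rightarrow> complex" where "e0 = (\<lambda>n. if n = 0 then 1 else 0)"
  define H where "H j = (if j = k + 1 then diag_poly e0 (k + 1)
      else if j = k then diag_poly (\<lambda>n. of_real (wt n)) k else (\<lambda>x. 0))" for j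
  have "diag_poly e0 (k + 1) x = x 0 ^ (k + 1)" for x
    unfolding diag_poly_def
    using suminf_finite[of "{0}" "\<lambda>n. e0 n * x n ^ (k + 1)"] by (simp add: e0_def)
  then have "Q x = (\<Sum>j\<le>k + 1. H j x)" for x
    by (simp add: Q_def H_def atMost_Suc lessThan_Suc_atMost[symmetric])
  moreover have "continuous_hom_poly_lp p j (H j)" for j
    using p wt by (auto simp: H_def e0_def continuous_hom_poly_zero intro!: continuous_hom_poly_diag)
  ultimately show ?thesis
    unfolding poly_lp_def by auto
qed

lemma norm_Q_le:
  assumes x: "x \<in> lp p" and le1: "lp_norm p x \<le> 1"
  shows "cmod (Q x) \<le> lp_norm p x ^ k"
    and "0 < lp_norm p x \<Longrightarrow> lp_norm p x < 1 \<Longrightarrow> cmod (Q x) < lp_norm p x ^ k"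
proof -
  \<comment> \<open>Merging the term of degree \<open>k + 1\<close> into index 0 of the series
    allows a termwise comparison with \<open>cmod (x n) ^ k\<close>. At index 0 only that term
    remains, and \<open>cmod (x 0) \<le> 1\<close> absorbs its extra factor.\<close>
  define f where "f n = (if n = 0 then cmod (x 0) ^ (k + 1) else 0) + wt n * cmod (x n) ^ k" for n
  note sm = lp_power_sum(1)[OF p x]
  have x0: "cmod (x 0) \<le> lp_norm p x"
    by (rule norm_le_lp_norm[OF p(1) x])
  have sw: "summable (\<lambda>n. wt n * cmod (x n) ^ k)"
    by (rule summable_comparison_test[OF _ sm])
      (use wt in \<open>auto simp: abs_mult less_imp_le intro!: mult_left_le_one_le\<close>)
  have f: "f sums (cmod (x 0) ^ (k + 1) + (\<Sum>n. wt n * cmod (x n) ^ k))"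
    unfolding f_def using sums_single[of 0 "\<lambda>_. cmod (x 0) ^ (k + 1)"]
    by (intro sums_add summable_sums sw)
  have "cmod (diag_poly (\<lambda>n. of_real (wt n)) k x) \<le> (\<Sum>n. wt n * cmod (x n) ^ k)"
    unfolding diag_poly_def
    by (intro norm_suminf_le sw) (simp add: norm_mult norm_power wt)
  then have Qf: "cmod (Q x) \<le> suminf f"
    unfolding Q_def sums_unique[OF f, symmetric]
    by (intro order_trans[OF norm_triangle_ineq] add_mono) (auto simp: norm_power norm_mult)
  have f_le: "f n \<le> cmod (x n) ^ k" for n
    using x0 le1 wt(1,2)[of n] wt(3)
    by (cases "n = 0") (auto simp: f_def less_imp_le intro!: mult_left_le_one_le)
  have "suminf f \<le> (\<Sum>n. cmod (x n) ^ k)"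
    by (intro suminf_le f_le sums_summable[OF f] sm)
  then show "cmod (Q x) \<le> lp_norm p x ^ k"
    using Qf lp_power_sum(2)[OF p x] by linarith
  assume r: "0 < lp_norm p x" "lp_norm p x < 1"
  then obtain m where m: "x m \<noteq> 0"
    using lp_norm_eq_0[OF p(1) x] by fastforce
  \<comment> \<open>For \<open>m = 0\<close> the gap comes from \<open>cmod (x 0) < 1\<close>,
    otherwise from \<open>wt m < 1\<close>. One strict term makes the whole sum strictly
    smaller.\<close>
  have "f m < cmod (x m) ^ k"
    using x0 r m wt(1,2)[of m] wt(3) by (cases "m = 0") (auto simp: f_def)
  then have "0 < (\<Sum>n. cmod (x n) ^ k - f n)"
    using f_le by (intro suminf_pos2[of _ m] summable_diff sm sums_summable[OF f]) auto
  then have "suminf f < (\<Sum>n. cmod (x n) ^ k)"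
    using suminf_diff[OF sm sums_summable[OF f]] by simp
  then show "cmod (Q x) < lp_norm p x ^ k"
    using Qf lp_power_sum(2)[OF p x] by linarith
qed

section \<open>Norms of \<open>Q\<close> and their attainment\<close>

lemma norm_Q_le_1:
  assumes "x \<in> lp p" "lp_norm p x \<le> 1"
  shows "cmod (Q x) \<le> 1"
  using norm_Q_le(1)[OF assms] power_le_one[OF lp_norm_nonneg assms(2)] by (rule order_trans)

text \<open>A real supremum dominates its members only when they are bounded above; here 1 is a
  bound because scaling by \<open>s\<close> stays inside the unit ball.\<close>

lemma s_norm_ge:
  assumes s: "0 \<le> s" "s \<le> 1" and y: "y \<in> lp_ball p"
  shows "cmod (Q (\<lambda>n. of_real s * y n)) \<le> s_norm p s Q"
  unfolding s_norm_def
proof (rule cSUP_upper[OF y bdd_aboveI2])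
  fix x assume "x \<in> lp_ball p"
  then show "cmod (Q (\<lambda>n. of_real s * x n)) \<le> 1"
    using s lp_scale[OF p(1), of x "of_real s"]
    by (intro norm_Q_le_1) (auto simp: lp_ball_def intro!: mult_le_one lp_norm_nonneg)
qed

lemma unit_in_ball: "0 \<le> c \<Longrightarrow> c < 1 \<Longrightarrow> (\<lambda>n. if n = m then of_real c else 0) \<in> lp_ball p"
  using lp_unit[OF p(1), of m "of_real c"] by (simp add: lp_ball_def)

lemma s_norm_ge_power:
  assumes s: "0 \<le> s" "s \<le> 1"
  shows "s ^ k \<le> s_norm p s Q"
proof (rule LIMSEQ_le_const2)
  \<comment> \<open>The test points are \<open>wt n\<close> times the n-th unit vector:
    \<open>wt n\<close> acts both as the weight in \<open>Q\<close> and as a radius below 1 that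
    tends to 1. Index 0 is left out because \<open>Q\<close> has degree \<open>k + 1\<close> along
    that axis.\<close>
  show "(\<lambda>n. wt n * (s * wt n) ^ k) \<longlonglongrightarrow> s ^ k"
    using wt_tendsto by (auto intro!: tendsto_eq_intros)
  show "\<exists>N. \<forall>n\<ge>N. wt n * (s * wt n) ^ k \<le> s_norm p s Q"
  proof (intro exI[of _ 1] allI impI)
    fix n :: nat assume "1 \<le> n"
    have eq: "(\<lambda>j. of_real s * (if j = n then of_real (wt n) else 0)) =
        (\<lambda>j. if j = n then of_real (s * wt n) else (0 :: complex))"
      by auto
    show "wt n * (s * wt n) ^ k \<le> s_norm p s Q"
      using s_norm_ge[OF s unit_in_ball[of "wt n" n]] wt(1,2)[of n] wt(3) s \<open>1 \<le> n\<close>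
      unfolding eq Q_unit by (simp add: norm_mult norm_power)
  qed
qed

lemma Q_attains_1_norm: "attains_s_norm p 1 Q"
proof -
  let ?e = "\<lambda>n. if n = 0 then 1 else (0 :: complex)"
  \<comment> \<open>The instance of \<open>unit_in_ball\<close> shows that the ball is nonempty, as
    the least-upper-bound rule requires.\<close>
  have "s_norm p 1 Q \<le> 1"
    unfolding s_norm_def using unit_in_ball[of 0]
    by (intro cSUP_least) (auto simp: lp_ball_def intro!: norm_Q_le_1)
  then have "s_norm p 1 Q = 1"
    using s_norm_ge_power[of 1] by simp
  moreover have "?e \<in> lp_cball p"
    using lp_unit[OF p(1), of 0 1] by (simp add: lp_cball_def)
  moreover have "cmod (Q ?e) = 1"
    using Q_unit[of 0 1] by simp
  ultimately show ?thesis
    unfolding attains_s_norm_def by force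
qed

lemma Q_not_attains_s_norm:
  assumes s: "0 < s" "s < 1"
  shows "\<not> attains_s_norm p s Q"
proof
  assume "attains_s_norm p s Q"
  then obtain y where y: "y \<in> lp p" "lp_norm p y \<le> 1"
    and eq: "cmod (Q (\<lambda>n. of_real s * y n)) = s_norm p s Q"
    by (auto simp: attains_s_norm_def lp_cball_def)
  define x where "x = (\<lambda>n. of_real s * y n)"
  have x: "x \<in> lp p" "lp_norm p x \<le> s"
    using lp_scale[OF p(1) y(1), of "of_real s"] s y by (auto simp: x_def)
  \<comment> \<open>The strict bound on \<open>Q\<close> needs a positive norm. At norm 0 the weak
    bound gives \<open>0 ^ k = 0\<close>, which is below \<open>s ^ k\<close>.\<close>
  have "cmod (Q x) < s ^ k"
  proof (cases "lp_norm p x = 0")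
    case True
    then show ?thesis
      using norm_Q_le(1)[OF x(1)] s k_pos by (auto simp: power_0_left)
  next
    case False
    then have "cmod (Q x) < lp_norm p x ^ k"
      using norm_Q_le(2)[OF x(1)] x s lp_norm_nonneg[of p x] by auto
    also have "\<dots> \<le> s ^ k"
      using x lp_norm_nonneg by (intro power_mono) auto
    finally show ?thesis .
  qed
  then show False
    using s_norm_ge_power[of s] s eq by (simp add: x_def)
qed

text \<open>The optimal radius need not be computed: a maximizer of norm \<open>r\<close> would be
  beaten on its own sphere, where multiples of unit vectors bring the value arbitrarily close to
  \<open>(1 - r\<^sup>2) * r ^ k\<close>.\<close>

lemma Q_not_attains_v_norm: "\<not> attains_v_norm p Q"
proof
  assume "attains_v_norm p Q"
  then obtain x where x: "x \<in> lp p" "lp_norm p x \<le> 1"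
    and eq: "(1 - (lp_norm p x)\<^sup>2) * cmod (Q x) = v_norm p Q"
    by (auto simp: attains_v_norm_def lp_cball_def)
  have ge: "(1 - (lp_norm p y)\<^sup>2) * cmod (Q y) \<le> v_norm p Q" if "y \<in> lp_ball p" for y
    unfolding v_norm_def
  proof (rule cSUP_upper[OF that bdd_aboveI2])
    fix z assume "z \<in> lp_ball p"
    then show "(1 - (lp_norm p z)\<^sup>2) * cmod (Q z) \<le> 1"
      using norm_Q_le_1[of z] lp_norm_nonneg[of p z]
      by (intro mult_le_one) (auto simp: lp_ball_def power_le_one)
  qed
  \<comment> \<open>The radius \<open>c\<close> is already below 1 and stays fixed; only the weight
    tends to 1.\<close>
  have ge_unit: "(1 - c\<^sup>2) * c ^ k \<le> v_norm p Q" if c: "0 \<le> c" "c < 1" for c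
  proof (rule LIMSEQ_le_const2)
    show "(\<lambda>n. (1 - c\<^sup>2) * (wt n * c ^ k)) \<longlonglongrightarrow> (1 - c\<^sup>2) * c ^ k"
      using wt_tendsto by (auto intro!: tendsto_eq_intros)
    show "\<exists>N. \<forall>n\<ge>N. (1 - c\<^sup>2) * (wt n * c ^ k) \<le> v_norm p Q"
    proof (intro exI[of _ 1] allI impI)
      fix n :: nat assume "1 \<le> n"
      then show "(1 - c\<^sup>2) * (wt n * c ^ k) \<le> v_norm p Q"
        using ge[OF unit_in_ball[OF c, of n]] lp_unit(2)[OF p(1), of n "of_real c"] 
          wt(1,2)[of n] c
        unfolding Q_unit by (simp add: norm_mult norm_power)
    qed
  qed
  \<comment> \<open>Positivity of the v-norm excludes a maximizer of norm 0 or 1, where the weighted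
    value vanishes. The radius 1/2 is an arbitrary choice in (0,1).\<close>
  have "0 < (1 - (1 / 2)\<^sup>2) * (1 / 2 :: real) ^ k"
    by (simp add: power2_eq_square)
  also have "\<dots> \<le> v_norm p Q"
    by (rule ge_unit) auto
  finally have pos: "0 < v_norm p Q" .
  define r where "r = lp_norm p x"
  have "r \<noteq> 1"
    using pos eq by (auto simp: r_def)
  moreover have "r \<noteq> 0"
    using pos eq norm_Q_le(1)[OF x] k_pos by (auto simp: r_def power_0_left)
  ultimately have r: "0 < r" "r < 1"
    using x lp_norm_nonneg[of p x] by (auto simp: r_def)
  have "v_norm p Q < (1 - r\<^sup>2) * r ^ k"
    using norm_Q_le(2)[OF x] r
    by (auto simp: r_def power_less_one_iff simp flip: eq intro!: mult_strict_left_mono)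
  then show False
    using ge_unit[of r] r by simp
qed

end

theorem proposition2p11:
  fixes p :: real and k :: nat
  assumes "1 \<le> p" and "p \<le> real k"
  shows "\<exists>Q \<in> poly_lp p (k + 1).
           Q \<in> NA_poly p (k + 1) \<and>
           (\<forall>s::real. 0 < s \<and> s < 1 \<longrightarrow> \<not> attains_s_norm p s Q) \<and>
           Q \<notin> NA_v_poly p (k + 1)"
proof -
  interpret weighted_lp p k
    by unfold_locales (use assms in auto)
  show ?thesis
    using Q_in_poly Q_attains_1_norm Q_not_attains_s_norm Q_not_attains_v_norm
    by (intro bexI[of _ Q]) (auto simp: NA_poly_def NA_v_poly_def)
qed

end
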